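(* Let $n\in\mathbb{N}$ and $0<t\leq 1$. Then $$ \begin{aligned} \sum_{k=1}^{\infty}\frac{(-t)^kH_{k-1}}{\binom{n+k}{k}}={}&\frac{t\log(t+1)}{t+1}+\frac{t}{(t+1)^2}\sum_{k=1}^n\frac{H_k}{k}\left(\frac{t+1}{t}\right)^k\\ &-\frac{t^2+t\log(t+1)}{(t+1)^2}\sum_{k=1}^n\frac{1}{k}\left(\frac{t+1}{t}\right)^k-\frac{\log^2(t+1)}{2(t+1)^2}\sum_{k=1}^nk\left(\frac{t+1}{t}\right)^k\\ &-\frac{t}{(t+1)^2}\sum_{p=0}^{n-1}\left\{\sum_{k=1}^{n-p}\left(\frac{H_{k+p}-H_k}{k(k+p)}+\frac{1}{k^2(k+p)}\right)\right\}p\left(\frac{t+1}{t}\right)^p\\ &-\frac{1}{(t+1)^2}\sum_{p=0}^{n-1}\left\{\sum_{k=1}^{n-p}\left(\frac{H_{k+p}-H_k}{k(k+p)}+\frac{1}{k^2(k+p)}\right)\right\}p^2\left(\frac{t+1}{t}\right)^p\\ &-\frac{2t-t\log(t+1)}{(t+1)^2}\sum_{k=1}^nH_k\left(\frac{t+1}{t}\right)^k+\frac{\log(t+1)}{(t+1)^2}\sum_{k=1}^nkH_k\left(\frac{t+1}{t}\right)^k\\ &+\frac{4t\log(t+1)-t\log^2(t+1)}{2(t+1)^2}\sum_{k=1}^n\left(\frac{t+1}{t}\right)^k. \end{aligned} $$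
   Context: $\mathbb{N}=\{1,2,3,\dots\}$. $H_m=\sum_{j=1}^m \frac1j$ is the $m$-th harmonic number, with $H_0=0$. $\log^2 x$ means $(\log x)^2$. Infinite series are limits of partial sums (possibly only conditionally convergent). *)

theory Defs
  imports "HOL-Analysis.Analysis"
begin

end

theory Submission
  imports Defs
begin

text \<open>
  Write \<open>b n k\<close> for the reciprocal of \<open>n + k choose k\<close>, \<open>r = (t + 1) / t\<close>, \<open>L = ln (t + 1)\<close>, and
  \<open>S n\<close> for the series. The proof evaluates \<open>S n\<close> in a form much simpler than the stated one
  (\<open>harmonic_closed_form\<close>) and then shows that the stated right-hand side is that form, pulled apart
  by summation by parts.

  The evaluation rests on the identity \<open>b (n + 1) k = (n + 1) / n * (b n k - b n (k + 1))\<close>. The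
  difference on the right, after a shift of the index, multiplies the series by \<open>r\<close>; the shift also
  turns \<open>H (k - 1)\<close> into \<open>H (k - 2)\<close>, which costs a series without harmonic numbers. So \<open>S (n + 1)\<close>
  is \<open>r * S n\<close> plus an auxiliary series, up to the factor \<open>(n + 1) / n\<close>. The auxiliary series splits
  by partial fractions into the series over \<open>b n k\<close> and over \<open>b n k / k\<close>. The latter obeys a
  recurrence of the same kind and equals \<open>- r ^ n\<close> times the tail beyond \<open>n\<close> of the expansion of
  \<open>L\<close> in powers of \<open>1 / r = t / (t + 1)\<close>; the former reduces to it. The only analysis lies in the
  starting values, which come from the power series of \<open>ln (1 + t)\<close> and of its square. Both are
  needed up to the end point \<open>t = 1\<close>, where they converge only conditionally; explicit remainder
  bounds on \<open>[0, t]\<close>, obtained by differentiating the partial sums, treat the end point and the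
  interior alike.

  For the comparison with the stated form, note that \<open>k\<close> and \<open>t\<close> occur there mostly through the
  combination \<open>(k + t) * r ^ k = t * (k * r ^ (k + 1) - (k - 1) * r ^ k)\<close>. Summation by parts removes
  \<open>t\<close> from the coefficients, and what is left is an identity between coefficients of powers of \<open>r\<close>.
  That identity involves the double sums over harmonic numbers only through a weighted difference of
  two neighbouring ones, and it is proved by induction (\<open>double_harmonic_sum_difference\<close>).
\<close>

section \<open>The power series of the logarithm and of its square\<close>

text \<open>
  A bound on the derivative integrates to a bound on the function. This turns the remainder of a
  differentiated partial sum, which is bounded by a multiple of a monomial, into the
  remainder of the partial sum itself, with no appeal to the radius of convergence.
\<close>
lemma abs_le_monomial_of_deriv_bound:
  fixes g g' :: "real \<Rightarrow> real"
  assumes "0 \<le> t" and "g 0 = 0"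
    and deriv: "\<And>x. 0 \<le> x \<Longrightarrow> x \<le> t \<Longrightarrow> (g has_real_derivative g' x) (at x)"
    and bound: "\<And>x. 0 \<le> x \<Longrightarrow> x \<le> t \<Longrightarrow> \<bar>g' x\<bar> \<le> C * x ^ m"
  shows "\<bar>g t\<bar> \<le> C * t ^ Suc m / real (Suc m)"
proof -
  have mono: "C * 0 ^ Suc m / real (Suc m) - s * g 0 \<le> C * t ^ Suc m / real (Suc m) - s * g t"
    if "\<bar>s\<bar> = 1" for s
  proof (rule DERIV_nonneg_imp_nondecreasing[OF \<open>0 \<le> t\<close>])
    fix x assume x: "0 \<le> x" "x \<le> t"
    have "((\<lambda>x. C * x ^ Suc m / real (Suc m) - s * g x) has_real_derivative
        (C * x ^ m - s * g' x)) (at x)"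
      using deriv[OF x] by (auto intro!: derivative_eq_intros simp: field_simps simp del: of_nat_Suc power_Suc)
    moreover have "s * g' x \<le> \<bar>s * g' x\<bar>" by simp
    then have "0 \<le> C * x ^ m - s * g' x"
      using bound[OF x] that by (simp add: abs_mult)
    ultimately show "\<exists>y. ((\<lambda>x. C * x ^ Suc m / real (Suc m) - s * g x) has_real_derivative y) (at x)
        \<and> 0 \<le> y" by blast
  qed
  show ?thesis
    using mono[of 1] mono[of "-1"] \<open>g 0 = 0\<close> by (simp add: abs_le_iff)
qed

lemma ln_series_remainder:
  fixes x :: real
  assumes "0 \<le> x"
  shows "\<bar>ln (1 + x) + (\<Sum>k=1..K. (- x) ^ k / real k)\<bar> \<le> x ^ Suc K / real (Suc K)"
proof -
  have geom: "(1 + y) * (\<Sum>k=1..K. (- y) ^ (k - 1)) = 1 - (- y) ^ K" for y :: real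
    by (induction K) (auto simp: algebra_simps)
  have "\<bar>ln (1 + x) + (\<Sum>k=1..K. (- x) ^ k / real k)\<bar> \<le> 1 * x ^ Suc K / real (Suc K)"
  proof (rule abs_le_monomial_of_deriv_bound[OF assms, where g' = "\<lambda>y. (- y) ^ K / (1 + y)"])
    show "ln (1 + 0) + (\<Sum>k=1..K. (- 0) ^ k / real k) = (0::real)"
      by (simp add: power_0_left)
  next
    fix y :: real assume y: "0 \<le> y" "y \<le> x"
    have "((\<lambda>y. ln (1 + y) + (\<Sum>k=1..K. (- y) ^ k / real k)) has_real_derivative
        1 / (1 + y) + (\<Sum>k=1..K. - ((- y) ^ (k - 1)))) (at y)"
      using y by (auto intro!: derivative_eq_intros sum.cong)
    also have "1 / (1 + y) + (\<Sum>k=1..K. - ((- y) ^ (k - 1))) = (- y) ^ K / (1 + y)"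
      using geom[of y] y by (simp add: sum_negf field_simps)
    finally show "((\<lambda>y. ln (1 + y) + (\<Sum>k=1..K. (- y) ^ k / real k)) has_real_derivative
        (- y) ^ K / (1 + y)) (at y)" .
    show "\<bar>(- y) ^ K / (1 + y)\<bar> \<le> 1 * y ^ K"
      using y by (simp add: abs_divide power_abs divide_le_eq mult_le_cancel_left1 ring_distribs)
  qed
  then show ?thesis by simp
qed

text \<open>
  The derivative of half the squared logarithm is \<open>ln (1 + y) / (1 + y)\<close>. Multiplying its partial sum
  by \<open>1 + y\<close> telescopes the harmonic coefficients to \<open>1 / k\<close>, so the remainder is that of the series
  for \<open>ln (1 + y)\<close> together with one boundary term; the two add up to the next harmonic number.
\<close>
lemma ln_squared_series_remainder:
  fixes x :: real
  assumes "0 \<le> x"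
  shows "\<bar>(ln (1 + x))\<^sup>2 / 2 - (\<Sum>k=0..K. (- x) ^ Suc k * harm k / real (Suc k))\<bar>
    \<le> harm (Suc K) * x ^ Suc (Suc K) / real (Suc (Suc K))"
proof (rule abs_le_monomial_of_deriv_bound[OF assms,
      where g' = "\<lambda>y. ln (1 + y) / (1 + y) + (\<Sum>k=0..K. (- y) ^ k * harm k)"])
  show "(ln (1 + 0))\<^sup>2 / 2 - (\<Sum>k=0..K. (- 0) ^ Suc k * harm k / real (Suc k)) = (0::real)"
    by simp
next
  fix y :: real assume y: "0 \<le> y" "y \<le> x"
  show "((\<lambda>y. (ln (1 + y))\<^sup>2 / 2 - (\<Sum>k=0..K. (- y) ^ Suc k * harm k / real (Suc k)))
      has_real_derivative ln (1 + y) / (1 + y) + (\<Sum>k=0..K. (- y) ^ k * harm k)) (at y)"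
  proof -
    have term_deriv: "((\<lambda>y. (- y) ^ Suc k * harm k / real (Suc k)) has_real_derivative
        - ((- y) ^ k * harm k)) (at y)" for k
      by (auto intro!: derivative_eq_intros simp: field_simps simp del: of_nat_Suc power_Suc)
    have "((\<lambda>y. (ln (1 + y))\<^sup>2 / 2) has_real_derivative ln (1 + y) / (1 + y)) (at y)"
      using y by (auto intro!: derivative_eq_intros simp: field_simps)
    from DERIV_diff[OF this DERIV_sum[OF term_deriv]] show ?thesis
      by (simp only: sum_negf diff_minus_eq_add)
  qed
  have telescope: "(1 + y) * (\<Sum>k=0..K. (- y) ^ k * harm k)
      = (\<Sum>k=1..K. (- y) ^ k / real k) - (- y) ^ Suc K * harm K"
    by (induction K) (auto simp: algebra_simps harm_Suc harm_expand(1) divide_inverse)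
  have "(1 + y) * (ln (1 + y) / (1 + y) + (\<Sum>k=0..K. (- y) ^ k * harm k))
      = (ln (1 + y) + (\<Sum>k=1..K. (- y) ^ k / real k)) - (- y) ^ Suc K * harm K"
    using y telescope by (simp add: distrib_left)
  also have "\<bar>\<dots>\<bar> \<le> y ^ Suc K / real (Suc K) + y ^ Suc K * harm K"
  proof (rule order_trans[OF abs_triangle_ineq4] add_mono)+
    show "\<bar>ln (1 + y) + (\<Sum>k=1..K. (- y) ^ k / real k)\<bar> \<le> y ^ Suc K / real (Suc K)"
      by (rule ln_series_remainder) (use y in simp)
    show "\<bar>(- y) ^ Suc K * harm K\<bar> \<le> y ^ Suc K * harm K"
      using y by (simp add: abs_mult power_abs harm_nonneg)
  qed
  also have "\<dots> = harm (Suc K) * y ^ Suc K"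
    by (simp add: harm_Suc field_simps del: of_nat_Suc power_Suc)
  also have "\<dots> \<le> (1 + y) * (harm (Suc K) * y ^ Suc K)"
    using y mult_right_mono[of 1 "1 + y" "harm (Suc K) * y ^ Suc K"]
    by (simp add: harm_nonneg del: power_Suc)
  finally have "(1 + y) * \<bar>ln (1 + y) / (1 + y) + (\<Sum>k=0..K. (- y) ^ k * harm k)\<bar>
      \<le> (1 + y) * (harm (Suc K) * y ^ Suc K)"
    using y by (simp add: abs_mult del: power_Suc)
  then show "\<bar>ln (1 + y) / (1 + y) + (\<Sum>k=0..K. (- y) ^ k * harm k)\<bar> \<le> harm (Suc K) * y ^ Suc K"
    using y by (simp add: mult_le_cancel_left_pos del: power_Suc)
qed

lemma ln_sums:
  fixes t :: real
  assumes "0 \<le> t" and "t \<le> 1"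
  shows "(\<lambda>j. (- t) ^ Suc j / real (Suc j)) sums - ln (t + 1)"
proof -
  have "(\<lambda>K. (\<Sum>k<K. (- t) ^ Suc k / real (Suc k)) - (- ln (t + 1))) \<longlonglongrightarrow> 0"
  proof (rule Lim_null_comparison)
    show "\<forall>\<^sub>F K in sequentially.
        norm ((\<Sum>k<K. (- t) ^ Suc k / real (Suc k)) - (- ln (t + 1))) \<le> 1 / real (Suc K)"
    proof (rule always_eventually, rule allI)
      fix K
      have "(\<Sum>k<K. (- t) ^ Suc k / real (Suc k)) = (\<Sum>k=1..K. (- t) ^ k / real k)"
        by (simp add: sum.atLeast1_atMost_eq)
      then have "norm ((\<Sum>k<K. (- t) ^ Suc k / real (Suc k)) - (- ln (t + 1))) \<le> t ^ Suc K / real (Suc K)"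
        using ln_series_remainder[OF \<open>0 \<le> t\<close>, of K] by (simp add: add.commute)
      also have "\<dots> \<le> 1 / real (Suc K)"
        using assms by (intro divide_right_mono power_le_one) auto
      finally show "norm ((\<Sum>k<K. (- t) ^ Suc k / real (Suc k)) - (- ln (t + 1))) \<le> 1 / real (Suc K)" .
    qed
    show "(\<lambda>K. 1 / real (Suc K)) \<longlonglongrightarrow> 0"
      using LIMSEQ_inverse_real_of_nat by (simp add: inverse_eq_divide)
  qed
  then show ?thesis unfolding sums_def by (rule LIM_zero_cancel)
qed

text \<open>
  The remainder bound for the squared logarithm at \<open>x = 1\<close> is of this order, so this limit is what
  makes that series converge at the end point.
\<close>
lemma harm_over_index_tendsto_0: "(\<lambda>n. harm n / real n) \<longlonglongrightarrow> 0"
proof (rule Lim_null_comparison)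
  show "\<forall>\<^sub>F n in sequentially. norm (harm n / real n) \<le> (ln (real n) + 1) / real n"
    using eventually_gt_at_top[of 0]
  proof eventually_elim
    case (elim n)
    have "harm n \<le> ln (real n) + 1"
      using euler_mascheroni_sequence_decreasing[of 1 n] elim by (simp add: harm_expand)
    then show ?case by (simp add: harm_nonneg divide_right_mono)
  qed
  have "(\<lambda>n. ln (real n) / real n + 1 / real n) \<longlonglongrightarrow> 0 + 0"
    by (intro tendsto_add lim_1_over_n lim_ln_over_n)
  then show "(\<lambda>n. (ln (real n) + 1) / real n) \<longlonglongrightarrow> 0" by (simp add: add_divide_distrib)
qed

lemma ln_squared_sums:
  fixes t :: real
  assumes "0 \<le> t" and "t \<le> 1"
  shows "(\<lambda>j. (- t) ^ Suc j * harm j / real (Suc j)) sums ((ln (t + 1))\<^sup>2 / 2)"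
proof -
  let ?s = "\<lambda>K. (\<Sum>k\<le>K. (- t) ^ Suc k * harm k / real (Suc k))"
  have "(\<lambda>K. ?s K - (ln (t + 1))\<^sup>2 / 2) \<longlonglongrightarrow> 0"
  proof (rule Lim_null_comparison)
    show "\<forall>\<^sub>F K in sequentially. norm (?s K - (ln (t + 1))\<^sup>2 / 2) \<le> harm (Suc K) / real (Suc K)"
    proof (rule always_eventually, rule allI)
      fix K
      have "norm (?s K - (ln (t + 1))\<^sup>2 / 2) \<le> harm (Suc K) * t ^ Suc (Suc K) / real (Suc (Suc K))"
        using ln_squared_series_remainder[OF \<open>0 \<le> t\<close>, of K]
        by (simp add: add.commute abs_minus_commute atLeast0AtMost)
      also have "\<dots> \<le> harm (Suc K) * 1 / real (Suc K)"
        using assms by (intro frac_le mult_left_mono mult_nonneg_nonneg power_le_one harm_nonneg) auto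
      finally show "norm (?s K - (ln (t + 1))\<^sup>2 / 2) \<le> harm (Suc K) / real (Suc K)" by simp
    qed
    show "(\<lambda>K. harm (Suc K) / real (Suc K)) \<longlonglongrightarrow> (0::real)"
      using harm_over_index_tendsto_0 by (rule LIMSEQ_Suc)
  qed
  then show ?thesis unfolding sums_def_le by (rule LIM_zero_cancel)
qed

section \<open>Series over reciprocal binomial coefficients\<close>

definition recip_binom :: "nat \<Rightarrow> nat \<Rightarrow> real" where
  "recip_binom n k = 1 / real ((n + k) choose k)"

lemma recip_binom_0_left [simp]: "recip_binom 0 k = 1"
  by (simp add: recip_binom_def)

lemma recip_binom_1_right: "recip_binom n (Suc 0) = 1 / real (Suc n)"
  by (simp add: recip_binom_def)

lemma recip_binom_Suc_right:
  "recip_binom n (Suc k) = recip_binom n k * real (Suc k) / real (Suc (n + k))"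
proof -
  have "real (Suc k) * real (Suc (n + k) choose Suc k) = real (Suc (n + k)) * real ((n + k) choose k)"
    using Suc_times_binomial[of k "n + k"] by (metis of_nat_mult)
  then show ?thesis
    by (simp add: recip_binom_def field_simps del: of_nat_Suc binomial_Suc_Suc)
qed

lemma recip_binom_Suc_left:
  "recip_binom (Suc n) k = recip_binom n k * real (Suc n) / real (Suc (n + k))"
proof -
  have "real (Suc n) * real (Suc (n + k) choose Suc n) = real (Suc (n + k)) * real ((n + k) choose n)"
    using Suc_times_binomial[of n "n + k"] by (metis of_nat_mult)
  moreover have "(n + k) choose n = (n + k) choose k" "Suc (n + k) choose Suc n = Suc (n + k) choose k"
    using binomial_symmetric[of n "n + k"] binomial_symmetric[of "Suc n" "Suc (n + k)"] by simp_all
  ultimately show ?thesis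
    by (simp add: recip_binom_def field_simps del: of_nat_Suc binomial_Suc_Suc)
qed

text \<open>
  Since \<open>ln (t + 1) = - ln (1 - t / (t + 1))\<close>, this is the remainder after \<open>n\<close> terms of
  the Mercator series at \<open>t / (t + 1)\<close>.
\<close>
definition ln_tail :: "real \<Rightarrow> nat \<Rightarrow> real" where
  "ln_tail t n = ln (t + 1) - (\<Sum>i=1..n. (t / (t + 1)) ^ i / real i)"

lemma ln_tail_Suc: "ln_tail t (Suc n) = ln_tail t n - (t / (t + 1)) ^ Suc n / real (Suc n)"
  by (simp add: ln_tail_def)

lemma power_times_ln_tail_Suc:
  fixes t :: real
  assumes "0 < t"
  shows "((t + 1) / t) ^ Suc n * ln_tail t (Suc n)
    = (t + 1) / t * (((t + 1) / t) ^ n * ln_tail t n) - 1 / real (Suc n)"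
proof -
  have "((t + 1) / t) ^ Suc n * (t / (t + 1)) ^ Suc n = 1"
    using assms by (simp flip: power_mult_distrib)
  then show ?thesis
    unfolding ln_tail_Suc by (simp add: right_diff_distrib del: of_nat_Suc)
qed

text \<open>
  The case \<open>n = 0\<close> is the logarithmic series. The step uses that \<open>b n k / k\<close> is the integral of
  \<open>x ^ (k - 1) * (1 - x) ^ n\<close> over \<open>[0, 1]\<close>: it drops by \<open>b (n + 1) k / k\<close> from \<open>k\<close> to \<open>k + 1\<close>.
  A shift of the index divides the series by \<open>- t\<close> apart from its first term.
\<close>
lemma sums_recip_binom_over_index:
  fixes t :: real
  assumes "0 < t" and "t \<le> 1"
  shows "(\<lambda>j. (- t) ^ Suc j * recip_binom n (Suc j) / real (Suc j)) sums
    - (((t + 1) / t) ^ n * ln_tail t n)"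
proof (induction n)
  case 0
  then show ?case using ln_sums[of t] assms by (simp add: ln_tail_def)
next
  case (Suc n)
  let ?f = "\<lambda>j. (- t) ^ Suc j * recip_binom n (Suc j) / real (Suc j)"
  let ?E = "((t + 1) / t) ^ n * ln_tail t n"
  have "(\<lambda>j. ?f (Suc j)) sums (- ?E - ?f 0)"
    using Suc.IH by (subst sums_Suc_iff) simp
  then have "(\<lambda>j. ?f j + ?f (Suc j) / t) sums (- ?E + (- ?E - ?f 0) / t)"
    by (intro sums_add sums_divide Suc.IH)
  also have "(\<lambda>j. ?f j + ?f (Suc j) / t) =
      (\<lambda>j. (- t) ^ Suc j * recip_binom (Suc n) (Suc j) / real (Suc j))"
  proof
    fix j
    have "recip_binom (Suc n) (Suc j) / real (Suc j)
        = recip_binom n (Suc j) / real (Suc j) - recip_binom n (Suc (Suc j)) / real (Suc (Suc j))"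
      by (simp add: recip_binom_Suc_left recip_binom_Suc_right[of n "Suc j"] divide_simps)
        (simp add: algebra_simps)
    moreover have "?f j + ?f (Suc j) / t = (- t) ^ Suc j *
        (recip_binom n (Suc j) / real (Suc j) - recip_binom n (Suc (Suc j)) / real (Suc (Suc j)))"
      using assms by (simp add: divide_simps) (simp add: algebra_simps)
    ultimately show "?f j + ?f (Suc j) / t = (- t) ^ Suc j * recip_binom (Suc n) (Suc j) / real (Suc j)"
      by (metis times_divide_eq_right)
  qed
  also have "- ?E + (- ?E - ?f 0) / t = - (((t + 1) / t) ^ Suc n * ln_tail t (Suc n))"
  proof -
    have f0: "?f 0 = - (t / real (Suc n))"
      by (simp add: recip_binom_1_right)
    have step: "- E + (- E - - (t / N)) / t = - ((t + 1) / t * E - 1 / N)" if "0 < N" for E N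
      using assms that by (simp add: divide_simps) (simp add: algebra_simps)
    show ?thesis
      unfolding f0 power_times_ln_tail_Suc[OF assms(1)] by (rule step) simp
  qed
  finally show ?case .
qed

text \<open>
  Reduced to the preceding series by \<open>b (m + 1) k = (m + 1) * b m (k + 1) / (k + 1)\<close>. Convergence at
  \<open>t = 1\<close> requires the first argument to be positive, hence the form \<open>Suc m\<close>.
\<close>
lemma sums_recip_binom:
  fixes t :: real
  assumes "0 < t" and "t \<le> 1"
  shows "(\<lambda>j. (- t) ^ Suc j * recip_binom (Suc m) (Suc j)) sums
    ((real (Suc m) * ((t + 1) / t) ^ Suc m * ln_tail t (Suc m) - t) / (t + 1))"
proof -
  let ?f = "\<lambda>j. (- t) ^ Suc j * recip_binom m (Suc j) / real (Suc j)"
  let ?E = "((t + 1) / t) ^ m * ln_tail t m"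
  have "(\<lambda>j. ?f (Suc j)) sums (- ?E - ?f 0)"
    using sums_recip_binom_over_index[OF assms] by (subst sums_Suc_iff) simp
  then have "(\<lambda>j. - (real (Suc m) / t) * ?f (Suc j)) sums (- (real (Suc m) / t) * (- ?E - ?f 0))"
    by (rule sums_mult)
  also have "(\<lambda>j. - (real (Suc m) / t) * ?f (Suc j)) = (\<lambda>j. (- t) ^ Suc j * recip_binom (Suc m) (Suc j))"
  proof
    fix j
    have "recip_binom (Suc m) (Suc j) = real (Suc m) * recip_binom m (Suc (Suc j)) / real (Suc (Suc j))"
      by (simp add: recip_binom_Suc_left recip_binom_Suc_right[of m "Suc j"] divide_simps)
    moreover have "- (real (Suc m) / t) * ?f (Suc j)
        = (- t) ^ Suc j * (real (Suc m) * recip_binom m (Suc (Suc j)) / real (Suc (Suc j)))"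
      using assms by (simp add: divide_simps)
    ultimately show "- (real (Suc m) / t) * ?f (Suc j) = (- t) ^ Suc j * recip_binom (Suc m) (Suc j)"
      by metis
  qed
  also have "- (real (Suc m) / t) * (- ?E - ?f 0)
      = (real (Suc m) * ((t + 1) / t) ^ Suc m * ln_tail t (Suc m) - t) / (t + 1)"
  proof -
    have f0: "?f 0 = - (t / real (Suc m))"
      by (simp add: recip_binom_1_right)
    have step: "- (N / t) * (- E - - (t / N)) = (N * ((t + 1) / t * E - 1 / N) - t) / (t + 1)"
      if "0 < N" for E N
      using assms that by (simp add: divide_simps) (simp add: algebra_simps)
    show ?thesis
      unfolding f0 mult.assoc[of "real (Suc m)"] power_times_ln_tail_Suc[OF assms(1)] by (rule step) simp
  qed
  finally show ?thesis .
qed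

text \<open>
  This series is what remains when the index shift replaces \<open>H (k - 1)\<close> by \<open>H (k - 1) - 1 / (k - 1)\<close>
  in the recurrence for the harmonic series. Partial fractions in \<open>k\<close> reduce it to the two series
  above.
\<close>
lemma sums_recip_binom_over_pred_index:
  fixes t :: real and m :: nat
  defines "n \<equiv> Suc m"
  assumes "0 < t" and "t \<le> 1"
  shows "(\<lambda>j. (- t) ^ Suc (Suc j) * recip_binom n (Suc (Suc j)) / real (Suc j)) sums
    ((t - real n) / (real n + 1) * (((t + 1) / t) ^ n * ln_tail t n) + real n * t / (real n + 1)\<^sup>2)"
proof -
  let ?e = "\<lambda>j. (- t) ^ Suc j * recip_binom n (Suc j) / real (Suc j)"
  let ?c = "\<lambda>j. (- t) ^ Suc j * recip_binom n (Suc j)"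
  let ?E = "((t + 1) / t) ^ n * ln_tail t n"
  let ?C = "(real n * ?E - t) / (t + 1)"
  have c: "?c sums ?C"
    using sums_recip_binom[OF assms(2,3), of m] by (simp add: n_def mult.assoc)
  have "(\<lambda>j. ?c (Suc j)) sums (?C - ?c 0)"
    using c by (subst sums_Suc_iff) simp
  then have "(\<lambda>j. - (t / (real n + 1)) * (?e j + ?c j + ?c (Suc j) / t)) sums
      (- (t / (real n + 1)) * (- ?E + ?C + (?C - ?c 0) / t))"
    by (intro sums_mult sums_add sums_divide c sums_recip_binom_over_index assms)
  also have "(\<lambda>j. - (t / (real n + 1)) * (?e j + ?c j + ?c (Suc j) / t))
      = (\<lambda>j. (- t) ^ Suc (Suc j) * recip_binom n (Suc (Suc j)) / real (Suc j))"
  proof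
    fix j
    have "recip_binom n (Suc (Suc j)) / real (Suc j) = 1 / (real n + 1) *
        (recip_binom n (Suc j) / real (Suc j) + recip_binom n (Suc j) - recip_binom n (Suc (Suc j)))"
      by (simp add: recip_binom_Suc_right[of n "Suc j"] divide_simps) (simp add: algebra_simps)
    moreover have "- (t / (real n + 1)) * (?e j + ?c j + ?c (Suc j) / t) =
        (- t) ^ Suc (Suc j) * (1 / (real n + 1) *
        (recip_binom n (Suc j) / real (Suc j) + recip_binom n (Suc j) - recip_binom n (Suc (Suc j))))"
      using assms by (simp add: divide_simps) (simp add: algebra_simps)
    ultimately show "- (t / (real n + 1)) * (?e j + ?c j + ?c (Suc j) / t)
        = (- t) ^ Suc (Suc j) * recip_binom n (Suc (Suc j)) / real (Suc j)"
      by (metis times_divide_eq_right)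
  qed
  also have "- (t / (real n + 1)) * (- ?E + ?C + (?C - ?c 0) / t)
      = (t - real n) / (real n + 1) * ?E + real n * t / (real n + 1)\<^sup>2"
  proof -
    have c0: "?c 0 = - (t / (real n + 1))"
      by (simp add: recip_binom_1_right add.commute)
    have step: "- (t / (N + 1)) * (- E + (N * E - t) / (t + 1) + ((N * E - t) / (t + 1) - - (t / (N + 1))) / t)
        = (t - N) / (N + 1) * E + N * t / (N + 1)\<^sup>2" if "N > 0" for E N
      using assms(2) that by (simp add: divide_simps power2_eq_square) (simp add: algebra_simps)
    show ?thesis unfolding c0 by (rule step) (simp add: n_def)
  qed
  finally show ?thesis .
qed

section \<open>The harmonic series in closed form\<close>

text \<open>
  For positive \<open>n\<close> this is \<open>n * r ^ n\<close> times the integral of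
  \<open>(1 - v) ^ (n - 1) * (1 - 1 / ((1 + t) * v)) * (ln (t + 1) + ln v)\<close> over \<open>v\<close> from \<open>1 / (1 + t)\<close> to \<open>1\<close>,
  which is where the Beta integral for the reciprocal binomial coefficients leads after summing the
  series under the integral sign.
\<close>
definition harmonic_closed_form :: "real \<Rightarrow> nat \<Rightarrow> real" where
  "harmonic_closed_form t n = ((t + 1) / t) ^ n / (t + 1) *
    (ln (t + 1) * (t + real n * harm n) - real n * (ln (t + 1))\<^sup>2 / 2
     - t * (\<Sum>i=1..n. (t / (t + 1)) ^ i / real i)
     - real n * (\<Sum>i=1..n. (t / (t + 1)) ^ i / real i * (harm n - harm (i - 1))))"

lemma harmonic_closed_form_Suc:
  fixes t :: real
  assumes "0 < t" and "0 < n"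
  shows "harmonic_closed_form t (Suc n) = real (Suc n) / real n *
    ((t + 1) / t * harmonic_closed_form t n - ((t - real n) / (real n + 1) *
      (((t + 1) / t) ^ n * ln_tail t n) + real n * t / (real n + 1)\<^sup>2) / t)"
proof -
  define L H N R W P Q where defs: "L = ln (t + 1)" "H = (harm n :: real)" "N = real n"
    "R = ((t + 1) / t) ^ n" "W = (t / (t + 1)) ^ n" "P = (\<Sum>i=1..n. (t / (t + 1)) ^ i / real i)"
    "Q = (\<Sum>i=1..n. (t / (t + 1)) ^ i / real i * (harm n - harm (i - 1)))"
  have pos: "0 < t" "0 < N" "0 < R" using assms by (auto simp: defs)
  \<comment> \<open>With \<open>W\<close> eliminated, the claim is a rational identity in \<open>t, N, R, L, H, P, Q\<close>.\<close>
  have "R * W = 1" using assms by (simp add: defs flip: power_mult_distrib)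
  then have W: "W = 1 / R" using pos by (simp add: field_simps)
  have P': "(\<Sum>i=1..Suc n. (t / (t + 1)) ^ i / real i) = P + t / (t + 1) * W / (N + 1)"
    by (simp add: defs add.commute)
  have "(\<Sum>i=1..Suc n. (t / (t + 1)) ^ i / real i * (harm (Suc n) - harm (i - 1)))
      = (\<Sum>i=1..n. (t / (t + 1)) ^ i / real i * (harm (Suc n) - harm (i - 1)))
        + t / (t + 1) * W / (N + 1) / (N + 1)"
    by (simp add: defs harm_Suc add.commute divide_inverse)
  also have "(\<Sum>i=1..n. (t / (t + 1)) ^ i / real i * (harm (Suc n) - harm (i - 1))) = Q + P / (N + 1)"
  proof -
    have "(t / (t + 1)) ^ i / real i * (harm (Suc n) - harm (i - 1))
        = (t / (t + 1)) ^ i / real i * (harm n - harm (i - 1)) + (t / (t + 1)) ^ i / real i / (N + 1)" for i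
    proof -
      have "harm (Suc n) = harm n + 1 / (N + 1)"
        by (simp add: defs harm_Suc inverse_eq_divide add.commute)
      moreover have "c * (h + e - g) = c * (h - g) + c * e" for c h e g :: real
        by (simp add: algebra_simps)
      ultimately show ?thesis
        by (simp only: times_divide_eq_right mult_1_right)
    qed
    then show ?thesis
      by (simp only: defs(6,7) sum.distrib sum_divide_distrib)
  qed
  finally have Q': "(\<Sum>i=1..Suc n. (t / (t + 1)) ^ i / real i * (harm (Suc n) - harm (i - 1)))
      = Q + P / (N + 1) + t / (t + 1) * W / (N + 1) / (N + 1)" .
  have H': "harm (Suc n) = H + 1 / (N + 1)"
    by (simp add: defs harm_Suc inverse_eq_divide add.commute)
  have key: "(t + 1) / t * R / (t + 1) * (L * (t + (N + 1) * (H + 1 / (N + 1))) - (N + 1) * L\<^sup>2 / 2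
        - t * (P + t / (t + 1) * W / (N + 1))
        - (N + 1) * (Q + P / (N + 1) + t / (t + 1) * W / (N + 1) / (N + 1)))
      = (N + 1) / N * ((t + 1) / t * (R / (t + 1) * (L * (t + N * H) - N * L\<^sup>2 / 2 - t * P - N * Q))
        - ((t - N) / (N + 1) * (R * (L - P)) + N * t / (N + 1)\<^sup>2) / t)"
    unfolding W using pos by (simp add: divide_simps power2_eq_square) (simp add: algebra_simps)
  have N': "real (Suc n) = N + 1" and R': "((t + 1) / t) ^ Suc n = (t + 1) / t * R"
    by (simp_all add: defs)
  show ?thesis
    using key unfolding harmonic_closed_form_def ln_tail_def Q' N' R' unfolding P' H' unfolding defs .
qed

text \<open>
  For \<open>m = 0\<close> the summand is \<open>(- t) ^ k * H (k - 1) / (k + 1)\<close>; writing \<open>H (k - 1) = H k - 1 / k\<close>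
  reduces it to the series of the squared logarithm and of the logarithm. The step is the recurrence
  described at the beginning.
\<close>
lemma sums_harm_recip_binom:
  fixes t :: real
  assumes "0 < t" and "t \<le> 1"
  shows "(\<lambda>j. (- t) ^ Suc j * harm j * recip_binom (Suc m) (Suc j)) sums
    harmonic_closed_form t (Suc m)"
proof (induction m)
  case 0
  let ?g = "\<lambda>j. (- t) ^ Suc j * harm j / real (Suc j)"
  let ?l = "\<lambda>j. (- t) ^ Suc j / real (Suc j)"
  let ?L = "ln (t + 1)"
  have g: "?g sums (?L\<^sup>2 / 2)" and l: "?l sums (- ?L)"
    using ln_squared_sums[of t] ln_sums[of t] assms by auto
  have g': "(\<lambda>j. ?g (Suc j)) sums (?L\<^sup>2 / 2 - ?g 0)"
    using g by (subst sums_Suc_iff) simp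
  have l': "(\<lambda>j. ?l (Suc j)) sums (- ?L - ?l 0)"
    using l by (subst sums_Suc_iff) simp
  have "(\<lambda>j. - (1 / t) * (?g (Suc j) + t * ?l j + ?l (Suc j))) sums
      (- (1 / t) * (?L\<^sup>2 / 2 - ?g 0 + t * (- ?L) + (- ?L - ?l 0)))"
    by (intro sums_mult sums_add g' l l')
  also have "(\<lambda>j. - (1 / t) * (?g (Suc j) + t * ?l j + ?l (Suc j)))
      = (\<lambda>j. (- t) ^ Suc j * harm j * recip_binom (Suc 0) (Suc j))"
  proof
    fix j
    have "recip_binom (Suc 0) (Suc j) = 1 / real (Suc (Suc j))"
      by (simp add: recip_binom_Suc_left)
    moreover have "- (1 / t) * (?g (Suc j) + t * ?l j + ?l (Suc j))
        = (- t) ^ Suc j * harm j * (1 / real (Suc (Suc j)))"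
      using assms by (simp add: harm_Suc divide_simps) (simp add: algebra_simps)
    ultimately show "- (1 / t) * (?g (Suc j) + t * ?l j + ?l (Suc j))
        = (- t) ^ Suc j * harm j * recip_binom (Suc 0) (Suc j)"
      by simp
  qed
  also have "- (1 / t) * (?L\<^sup>2 / 2 - ?g 0 + t * (- ?L) + (- ?L - ?l 0)) = harmonic_closed_form t (Suc 0)"
    using assms by (simp add: harmonic_closed_form_def harm_expand divide_simps) (simp add: algebra_simps)
  finally show ?case .
next
  case (Suc m)
  define n where "n = Suc m"
  let ?d = "\<lambda>j. (- t) ^ Suc j * harm j * recip_binom n (Suc j)"
  let ?a = "\<lambda>j. (- t) ^ Suc (Suc j) * recip_binom n (Suc (Suc j)) / real (Suc j)"
  let ?S = "harmonic_closed_form t n"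
  let ?A = "(t - real n) / (real n + 1) * (((t + 1) / t) ^ n * ln_tail t n) + real n * t / (real n + 1)\<^sup>2"
  have d: "?d sums ?S" using Suc.IH by (simp add: n_def)
  then have d': "(\<lambda>j. ?d (Suc j)) sums (?S - ?d 0)"
    by (subst sums_Suc_iff) simp
  have a: "?a sums ?A"
    using sums_recip_binom_over_pred_index[OF assms, of m] unfolding n_def .
  have "(\<lambda>j. real (Suc n) / real n * (?d j + ?d (Suc j) / t - ?a j / t)) sums
      (real (Suc n) / real n * (?S + (?S - ?d 0) / t - ?A / t))"
    by (intro sums_mult sums_diff sums_add sums_divide d d' a)
  also have "(\<lambda>j. real (Suc n) / real n * (?d j + ?d (Suc j) / t - ?a j / t))
      = (\<lambda>j. (- t) ^ Suc j * harm j * recip_binom (Suc n) (Suc j))"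
  proof
    fix j
    have "?d j + ?d (Suc j) / t - ?a j / t
        = (- t) ^ Suc j * harm j * (recip_binom n (Suc j) - recip_binom n (Suc (Suc j)))"
      using assms by (simp add: harm_Suc divide_simps) (simp add: algebra_simps)
    moreover have "recip_binom (Suc n) (Suc j)
        = real (Suc n) / real n * (recip_binom n (Suc j) - recip_binom n (Suc (Suc j)))"
      by (simp add: n_def recip_binom_Suc_left[of "Suc m"] recip_binom_Suc_right[of "Suc m" "Suc j"]
          divide_simps) (simp add: algebra_simps)
    ultimately show "real (Suc n) / real n * (?d j + ?d (Suc j) / t - ?a j / t)
        = (- t) ^ Suc j * harm j * recip_binom (Suc n) (Suc j)"
      by simp
  qed
  also have "real (Suc n) / real n * (?S + (?S - ?d 0) / t - ?A / t) = harmonic_closed_form t (Suc n)"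
    using assms by (subst harmonic_closed_form_Suc)
      (simp_all add: n_def harm_expand add_divide_distrib distrib_right del: of_nat_Suc power_Suc)
  finally show ?case by (simp only: n_def)
qed

section \<open>Summation by parts against powers of \<open>r\<close>\<close>

text \<open>
  The weight \<open>(k + t) * r ^ k\<close> is the difference of \<open>t * (k - 1) * r ^ k\<close> and its successor, because
  \<open>t * r = t + 1\<close>. The sum on the right has no boundary contribution at \<open>k = 1\<close>, whatever \<open>h 0\<close> is.
\<close>
lemma sum_by_parts_shifted_geometric:
  fixes t r :: real and h :: "nat \<Rightarrow> real"
  assumes "t * r = t + 1"
  shows "(\<Sum>k=1..n. (real k + t) * h k * r ^ k) = t * (real n * h n * r ^ Suc n
    - (\<Sum>k=1..n. (real k - 1) * (h k - h (k - 1)) * r ^ k))"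
proof (induction n)
  case (Suc n)
  have "t * (a * (r * b)) = (t + 1) * (a * b)" for a b
    using assms by (metis mult.assoc mult.left_commute)
  from this[of "real (Suc n) * h (Suc n)" "r ^ Suc n"]
  have "t * (real (Suc n) * h (Suc n) * r ^ Suc (Suc n)) = (t + 1) * (real (Suc n) * h (Suc n) * r ^ Suc n)"
    by simp
  with Suc show ?case by (simp add: algebra_simps del: power_Suc)
qed simp

text \<open>
  Here \<open>t * (r - 1) = 1\<close> makes the difference of \<open>t * r ^ k\<close> equal to \<open>r ^ k\<close>, so that a factor \<open>t\<close>
  can be traded for passing from the differences of \<open>D\<close> to \<open>D\<close> itself.
\<close>
lemma sum_geometric_by_parts:
  fixes t r :: real and D :: "nat \<Rightarrow> real"
  assumes "t * r = t + 1" and "D 0 = 0"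
  shows "t * (\<Sum>k=1..n. (D k - D (k - 1)) * r ^ k) = t * D n * r ^ Suc n - (\<Sum>k=1..n. D k * r ^ k)"
proof (induction n)
  case (Suc n)
  have "t * (a * (r * b)) = (t + 1) * (a * b)" for a b
    using assms(1) by (metis mult.assoc mult.left_commute)
  from this[of "D (Suc n)" "r ^ Suc n"]
  have "t * (D (Suc n) * r ^ Suc (Suc n)) = (t + 1) * (D (Suc n) * r ^ Suc n)"
    by simp
  with Suc show ?case by (simp add: algebra_simps del: power_Suc)
qed (simp add: assms)

definition double_harmonic_sum :: "nat \<Rightarrow> nat \<Rightarrow> real" where
  "double_harmonic_sum n p = (\<Sum>k=1..n-p. (harm (k + p) - harm k) / (real k * real (k + p))
    + 1 / ((real k)\<^sup>2 * real (k + p)))"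

text \<open>
  With \<open>k = j + 1\<close> and \<open>n = k + d\<close>, this is the comparison of the coefficients of \<open>r ^ k\<close> in the two
  closed forms. For fixed \<open>k\<close>, raising \<open>n\<close> by one adds a single explicit term to each double sum, so
  the induction step is a rational identity in \<open>j\<close>, \<open>d\<close> and the two harmonic numbers involved. In the
  base case the first double sum is empty and the second consists of one term.
\<close>
lemma double_harmonic_sum_difference:
  "harm (Suc j + d) - harm (Suc j) - harm d
      - real (Suc j + d) * (harm (Suc j + d) - harm d) / real (Suc d)
    = harm (Suc j) / real (Suc j) - 2 * harm (Suc j)
      + real j * (real (Suc j) * double_harmonic_sum (Suc j + d) (Suc j)
                  - real j * double_harmonic_sum (Suc j + d) j)"
proof (induction d)
  case 0
  have "double_harmonic_sum (Suc j) (Suc j) = 0" "double_harmonic_sum (Suc j) j = harm (Suc j) / real (Suc j)"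
    by (simp_all add: double_harmonic_sum_def harm_expand field_simps)
  then show ?case by (simp add: harm_expand field_simps)
next
  case (Suc d)
  define J D X Y where defs: "J = real j" "D = real d" "X = (harm (Suc j + d) :: real)" "Y = (harm d :: real)"
  have pos: "J \<ge> 0" "D \<ge> 0" by (simp_all add: defs)
  have X': "harm (Suc j + Suc d) = X + 1 / (J + D + 2)" and Y': "harm (Suc d) = Y + 1 / (D + 1)"
    by (simp_all add: defs harm_Suc inverse_eq_divide add_ac)
  have Y'': "harm (Suc (Suc d)) = Y + 1 / (D + 1) + 1 / (D + 2)"
    by (simp add: defs harm_Suc inverse_eq_divide add_ac)
  have "double_harmonic_sum (Suc j + Suc d) (Suc j) = double_harmonic_sum (Suc j + d) (Suc j)
      + ((harm (Suc j + Suc d) - harm (Suc d)) / (real (Suc d) * real (Suc j + Suc d))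
      + 1 / ((real (Suc d))\<^sup>2 * real (Suc j + Suc d)))"
    by (simp add: double_harmonic_sum_def add_ac)
  then have c1: "double_harmonic_sum (Suc j + Suc d) (Suc j) = double_harmonic_sum (Suc j + d) (Suc j)
      + ((X + 1 / (J + D + 2) - (Y + 1 / (D + 1))) / ((D + 1) * (J + D + 2))
      + 1 / ((D + 1)\<^sup>2 * (J + D + 2)))"
    unfolding X' Y' by (simp add: defs add_ac)
  have "double_harmonic_sum (Suc j + Suc d) j = double_harmonic_sum (Suc j + d) j
      + ((harm (Suc j + Suc d) - harm (Suc (Suc d))) / (real (Suc (Suc d)) * real (Suc j + Suc d))
      + 1 / ((real (Suc (Suc d)))\<^sup>2 * real (Suc j + Suc d)))"
    by (simp add: double_harmonic_sum_def add_ac)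
  then have c2: "double_harmonic_sum (Suc j + Suc d) j = double_harmonic_sum (Suc j + d) j
      + ((X + 1 / (J + D + 2) - (Y + 1 / (D + 1) + 1 / (D + 2))) / ((D + 2) * (J + D + 2))
      + 1 / ((D + 2)\<^sup>2 * (J + D + 2)))"
    unfolding X' Y'' by (simp add: defs add_ac)
  have step: "(X + 1 / (J + D + 2) - (Y + 1 / (D + 1)) - (J + D + 2) * (X + 1 / (J + D + 2) - (Y + 1 / (D + 1))) / (D + 2))
      - (X - Y - (J + D + 1) * (X - Y) / (D + 1))
    = J * ((J + 1) * ((X + 1 / (J + D + 2) - (Y + 1 / (D + 1))) / ((D + 1) * (J + D + 2))
      + 1 / ((D + 1)\<^sup>2 * (J + D + 2)))
      - J * ((X + 1 / (J + D + 2) - (Y + 1 / (D + 1) + 1 / (D + 2))) / ((D + 2) * (J + D + 2))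
      + 1 / ((D + 2)\<^sup>2 * (J + D + 2))))"
  proof -
    have "D + 1 \<noteq> 0" "D + 2 \<noteq> 0" "J + D + 2 \<noteq> 0" using pos by auto
    then show ?thesis
      by (simp add: divide_simps power2_eq_square) (simp add: algebra_simps)
  qed
  have reals: "real (Suc j) = J + 1" "real j = J" "real (Suc d) = D + 1" "real (Suc (Suc d)) = D + 2"
    "real (Suc j + d) = J + D + 1" "real (Suc j + Suc d) = J + D + 2"
    by (simp_all add: defs)
  from Suc.IH step show ?case
    unfolding c1 c2 unfolding X' Y' reals unfolding defs(3,4)[symmetric]
    by (simp add: algebra_simps)
qed

text \<open>
  The part of the closed form that is free of logarithms, matched with the corresponding sums of the
  stated form. Reversing the summation turns \<open>(1 / r) ^ i\<close> into powers \<open>r ^ k\<close> with \<open>k = n + 1 - i\<close>.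
  The terms with coefficient \<open>t\<close> then contain \<open>1 / k - 1 / (n + 1 - k)\<close>, which is the difference of
  \<open>D k = H k + H (n - k) - H n\<close>; since \<open>D\<close> vanishes at \<open>0\<close> and at \<open>n\<close>, summation by parts eliminates
  \<open>t\<close> without boundary terms.
\<close>
lemma sum_double_harmonic_by_parts:
  fixes t r :: real
  assumes "t * r = t + 1" and "r \<noteq> 0"
  shows "r ^ Suc n * (t * (\<Sum>i=1..n. (1 / r) ^ i / real i)
      + real n * (\<Sum>i=1..n. (1 / r) ^ i / real i * (harm n - harm (i - 1))))
    = t * (\<Sum>k=1..n. 1 / real k * r ^ k) - (\<Sum>k=1..n. harm k / real k * r ^ k)
      + 2 * (\<Sum>k=1..n. harm k * r ^ k)
      - (\<Sum>k=1..n. (real k - 1) * (real k * double_harmonic_sum n k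
          - real (k - 1) * double_harmonic_sum n (k - 1)) * r ^ k)"
proof -
  define D where "D k = harm k + harm (n - k) - (harm n :: real)" for k
  let ?q = "\<lambda>k. (t + real n * (harm n - harm (n - k))) / real (Suc n - k)"
  have "r ^ Suc n * (t * (\<Sum>i=1..n. (1 / r) ^ i / real i)
      + real n * (\<Sum>i=1..n. (1 / r) ^ i / real i * (harm n - harm (i - 1))))
    = (\<Sum>i=1..n. (t + real n * (harm n - harm (i - 1))) / real i * r ^ (Suc n - i))"
    (is "?lhs = _")
  proof -
    have split: "(t + N * h) / c * (x * y) = x * (t * (y / c)) + x * (N * (y / c * h))"
      for N h c x y :: real
      by (simp add: divide_inverse algebra_simps)
    have "(t + real n * (harm n - harm (i - 1))) / real i * r ^ (Suc n - i)
        = r ^ Suc n * (t * ((1 / r) ^ i / real i)) + r ^ Suc n * (real n * ((1 / r) ^ i / real i * (harm n - harm (i - 1))))"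
      if "i \<in> {1..n}" for i
    proof -
      have "r ^ (Suc n - i) = r ^ Suc n * (1 / r) ^ i"
        using that \<open>r \<noteq> 0\<close> by (simp add: power_one_over power_diff)
      then show ?thesis by (simp only: split)
    qed
    then show ?thesis
      by (simp add: distrib_left sum_distrib_left sum.distrib del: power_Suc)
  qed
  also have "\<dots> = (\<Sum>k=1..n. ?q k * r ^ k)"
  proof (subst sum.atLeastAtMost_rev, rule sum.cong[OF refl])
    fix k assume "k \<in> {1..n}"
    then show "(t + real n * (harm n - harm (n + 1 - k - 1))) / real (n + 1 - k) * r ^ (Suc n - (n + 1 - k))
        = ?q k * r ^ k" by simp
  qed
  also have "\<dots> = (\<Sum>k=1..n. t * (1 / real k * r ^ k) - harm k / real k * r ^ k + 2 * (harm k * r ^ k)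
      - (real k - 1) * (real k * double_harmonic_sum n k
          - real (k - 1) * double_harmonic_sum n (k - 1)) * r ^ k
      - (t * ((D k - D (k - 1)) * r ^ k) + D k * r ^ k))"
  proof (rule sum.cong[OF refl])
    fix k assume "k \<in> {1..n}"
    then obtain j d where k: "k = Suc j" and n: "n = Suc j + d"
      by (metis Suc_le_D add_diff_inverse_nat atLeastAtMost_iff not_less One_nat_def)
    have q: "?q k = (t + real n * (harm n - harm d)) / real (Suc d)"
      by (simp add: k n Suc_diff_le)
    have "D k - D (k - 1) = 1 / real k - 1 / real (Suc d)"
      by (simp add: D_def k n Suc_diff_le harm_Suc inverse_eq_divide)
    moreover have "D k = harm k + harm d - harm n"
      by (simp add: D_def k n)
    ultimately have "?q k = t / real k - harm k / real k + 2 * harm k - (real k - 1) *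
        (real k * double_harmonic_sum n k - real (k - 1) * double_harmonic_sum n (k - 1))
        - (t * (D k - D (k - 1)) + D k)"
      using double_harmonic_sum_difference[of j d]
      unfolding q by (simp add: k n add_divide_distrib right_diff_distrib del: of_nat_Suc) (simp add: algebra_simps)
    then show "?q k * r ^ k = t * (1 / real k * r ^ k) - harm k / real k * r ^ k + 2 * (harm k * r ^ k)
      - (real k - 1) * (real k * double_harmonic_sum n k
          - real (k - 1) * double_harmonic_sum n (k - 1)) * r ^ k
      - (t * ((D k - D (k - 1)) * r ^ k) + D k * r ^ k)"
      by (simp only:) (simp add: algebra_simps)
  qed
  also have "\<dots> = t * (\<Sum>k=1..n. 1 / real k * r ^ k) - (\<Sum>k=1..n. harm k / real k * r ^ k)
      + 2 * (\<Sum>k=1..n. harm k * r ^ k)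
      - (\<Sum>k=1..n. (real k - 1) * (real k * double_harmonic_sum n k
          - real (k - 1) * double_harmonic_sum n (k - 1)) * r ^ k)
      - (t * (\<Sum>k=1..n. (D k - D (k - 1)) * r ^ k) + (\<Sum>k=1..n. D k * r ^ k))"
    by (simp only: sum.distrib sum_subtractf sum_distrib_left)
  also have "t * (\<Sum>k=1..n. (D k - D (k - 1)) * r ^ k) + (\<Sum>k=1..n. D k * r ^ k) = 0"
    using sum_geometric_by_parts[OF assms(1), of D n] by (simp add: D_def harm_expand)
  finally show ?thesis by simp
qed

section \<open>The stated evaluation\<close>

text \<open>
  After the double sums are abbreviated, the nine finite sums are related by the four summations by
  parts \<open>S38\<close>, \<open>S67\<close>, \<open>S45\<close> and \<open>Y\<close> below, one each for the coefficient of the squared logarithm,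
  the coefficient of the logarithm, the double sums and the part of the closed form without
  logarithms. Substituting them collapses the right-hand side to the closed form.
\<close>
theorem theorem2p16:
  fixes n :: nat and t :: real
  assumes "n \<ge> 1" and "0 < t" and "t \<le> 1"
  shows "(\<lambda>j. let k = j + 1 in (- t) ^ k * harm (k - 1) / real ((n + k) choose k)) sums
    (t * ln (t + 1) / (t + 1)
     + t / (t + 1)^2 * (\<Sum>k=1..n. harm k / real k * ((t + 1) / t) ^ k)
     - (t^2 + t * ln (t + 1)) / (t + 1)^2 * (\<Sum>k=1..n. 1 / real k * ((t + 1) / t) ^ k)
     - (ln (t + 1))^2 / (2 * (t + 1)^2) * (\<Sum>k=1..n. real k * ((t + 1) / t) ^ k)
     - t / (t + 1)^2 *
         (\<Sum>p=0..n-1.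
            (\<Sum>k=1..n-p. (harm (k + p) - harm k) / (real k * real (k + p))
                         + 1 / ((real k)^2 * real (k + p)))
            * real p * ((t + 1) / t) ^ p)
     - 1 / (t + 1)^2 *
         (\<Sum>p=0..n-1.
            (\<Sum>k=1..n-p. (harm (k + p) - harm k) / (real k * real (k + p))
                         + 1 / ((real k)^2 * real (k + p)))
            * (real p)^2 * ((t + 1) / t) ^ p)
     - (2 * t - t * ln (t + 1)) / (t + 1)^2 * (\<Sum>k=1..n. harm k * ((t + 1) / t) ^ k)
     + ln (t + 1) / (t + 1)^2 * (\<Sum>k=1..n. real k * harm k * ((t + 1) / t) ^ k)
     + (4 * t * ln (t + 1) - t * (ln (t + 1))^2) / (2 * (t + 1)^2)
         * (\<Sum>k=1..n. ((t + 1) / t) ^ k))"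
proof -
  define r where "r = (t + 1) / t"
  define L where "L = ln (t + 1)"
  define N where "N = real n"
  define H where "H = (harm n :: real)"
  define R where "R = r ^ n"
  define S1 where "S1 = (\<Sum>k=1..n. harm k / real k * r ^ k)"
  define S2 where "S2 = (\<Sum>k=1..n. 1 / real k * r ^ k)"
  define S3 where "S3 = (\<Sum>k=1..n. real k * r ^ k)"
  define S4 where "S4 = (\<Sum>p=0..n-1. double_harmonic_sum n p * real p * r ^ p)"
  define S5 where "S5 = (\<Sum>p=0..n-1. double_harmonic_sum n p * (real p)\<^sup>2 * r ^ p)"
  define S6 where "S6 = (\<Sum>k=1..n. harm k * r ^ k)"
  define S7 where "S7 = (\<Sum>k=1..n. real k * harm k * r ^ k)"
  define S8 where "S8 = (\<Sum>k=1..n. r ^ k)"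
  define X where "X = (\<Sum>k=1..n. (real k - 1) * (real k * double_harmonic_sum n k
          - real (k - 1) * double_harmonic_sum n (k - 1)) * r ^ k)"
  define Y where "Y = t * (\<Sum>i=1..n. (1 / r) ^ i / real i)
      + real n * (\<Sum>i=1..n. (1 / r) ^ i / real i * (harm n - harm (i - 1)))"
  have tr: "t * r = t + 1" and r_nz: "r \<noteq> 0" using assms by (simp_all add: r_def)
  have S38: "S3 = t * N * R * r - t * S8"
  proof -
    have "(\<Sum>k=1..n. (real k + t) * 1 * r ^ k) = S3 + t * S8"
      by (simp add: S3_def S8_def distrib_right sum.distrib sum_distrib_left)
    then show ?thesis
      using sum_by_parts_shifted_geometric[OF tr, of "\<lambda>_. 1" n] by (simp add: N_def R_def mult_ac)
  qed
  have S67: "S7 = t * (N * H * R * r - (S8 - S2)) - t * S6"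
  proof -
    have diff: "(\<Sum>k=1..n. (real k - 1) * (harm k - harm (k - 1)) * r ^ k) = S8 - S2"
      unfolding S8_def S2_def sum_subtractf[symmetric]
    proof (rule sum.cong[OF refl])
      fix k assume "k \<in> {1..n}"
      then obtain j where "k = Suc j" by (cases k) auto
      then show "(real k - 1) * (harm k - harm (k - 1)) * r ^ k = r ^ k - 1 / real k * r ^ k"
        by (simp add: harm_Suc field_simps)
    qed
    have lhs: "(\<Sum>k=1..n. (real k + t) * harm k * r ^ k) = S7 + t * S6"
      by (simp add: S7_def S6_def distrib_right sum.distrib sum_distrib_left mult.assoc)
    from sum_by_parts_shifted_geometric[OF tr, of harm n] show ?thesis
      unfolding diff lhs by (simp add: N_def H_def R_def algebra_simps)
  qed
  have S8: "S8 = t * (R * r - r)"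
  proof -
    have "(\<Sum>k=1..n. r ^ k) = t * (r ^ n * r - r)"
    proof (induction n)
      case (Suc n)
      have "r ^ Suc n = (t * r - t) * r ^ Suc n" using tr by simp
      with Suc show ?case by (simp add: algebra_simps)
    qed simp
    then show ?thesis by (simp add: S8_def R_def)
  qed
  have S45: "t * S4 + S5 = - t * X"
  proof -
    obtain m where n: "n = Suc m" using assms(1) by (cases n) auto
    \<comment> \<open>The empty double sum at \<open>p = n\<close> allows the range to be extended, and kills the boundary term.\<close>
    have diag: "double_harmonic_sum n n = 0" by (simp add: double_harmonic_sum_def)
    have "t * S4 + S5 = (\<Sum>p=0..m. (real p + t) * (real p * double_harmonic_sum n p) * r ^ p)"
      by (simp add: S4_def S5_def n sum_distrib_left sum.distrib[symmetric] power2_eq_square algebra_simps)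
    also have "\<dots> = (\<Sum>p=1..m. (real p + t) * (real p * double_harmonic_sum n p) * r ^ p)"
      by (simp add: sum.atLeast_Suc_atMost)
    also have "\<dots> = (\<Sum>p=1..n. (real p + t) * (real p * double_harmonic_sum n p) * r ^ p)"
      using diag by (simp add: n)
    also have "\<dots> = - t * X"
      using sum_by_parts_shifted_geometric[OF tr, of "\<lambda>p. real p * double_harmonic_sum n p" n] diag
      by (simp add: X_def)
    finally show ?thesis .
  qed
  have Y: "R * r * Y = t * S2 - S1 + 2 * S6 - X"
    using sum_double_harmonic_by_parts[OF tr r_nz, of n]
    by (simp add: R_def Y_def S1_def S2_def S6_def X_def mult.commute)
  have w: "t / (t + 1) = 1 / r" by (simp add: r_def)
  have closed: "harmonic_closed_form t n = R / (t + 1) * (L * (t + N * H) - N * L\<^sup>2 / 2 - Y)"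
    unfolding harmonic_closed_form_def w
    by (simp add: R_def L_def N_def H_def Y_def r_def diff_diff_eq)
  have pos: "0 < t" "t + 1 \<noteq> 0" using assms by auto
  have S5: "S5 = - t * X - t * S4" using S45 by simp
  have RY: "R * Y * (t + 1) = t * (t * S2 - S1 + 2 * S6 - X)"
    using Y tr by (metis mult.assoc mult.commute)
  have main: "(t * L / (t + 1) + t / (t + 1)\<^sup>2 * S1 - (t\<^sup>2 + t * L) / (t + 1)\<^sup>2 * S2
      - L\<^sup>2 / (2 * (t + 1)\<^sup>2) * S3 - t / (t + 1)\<^sup>2 * S4 - 1 / (t + 1)\<^sup>2 * S5
      - (2 * t - t * L) / (t + 1)\<^sup>2 * S6 + L / (t + 1)\<^sup>2 * S7
      + (4 * t * L - t * L\<^sup>2) / (2 * (t + 1)\<^sup>2) * S8) = harmonic_closed_form t n" (is "?lhs = _")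
  proof -
    have "2 * (t + 1)\<^sup>2 * ?lhs = 2 * t * L * (t + 1) + 2 * t * S1 - 2 * (t\<^sup>2 + t * L) * S2
      - L\<^sup>2 * S3 - 2 * t * S4 - 2 * S5 - 2 * (2 * t - t * L) * S6 + 2 * L * S7
      + (4 * t * L - t * L\<^sup>2) * S8"
      using pos(2) by (simp add: divide_simps power2_eq_square) (simp add: algebra_simps)
    also have "\<dots> = 2 * t * L * (t + 1) + 2 * t * (N * H * (R * r) + S8) * L - L\<^sup>2 * (t * N * (R * r))
        - 2 * (t * (t * S2 - S1 + 2 * S6 - X))"
      unfolding S38 S67 S5 by (simp add: algebra_simps power2_eq_square)
    also have "\<dots> = 2 * t * L * (t + 1) + 2 * (t * r) * (N * H * R + t * R - t) * L - L\<^sup>2 * ((t * r) * N * R)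
        - 2 * (R * Y * (t + 1))"
      unfolding S8 RY by (simp add: algebra_simps power2_eq_square)
    also have "\<dots> = 2 * (t + 1)\<^sup>2 * harmonic_closed_form t n"
      unfolding tr closed using pos(2) by (simp add: divide_simps power2_eq_square) (simp add: algebra_simps)
    finally show ?thesis using pos(2) by simp
  qed
  obtain m where "n = Suc m" using assms(1) by (cases n) auto
  then have "(\<lambda>j. (- t) ^ Suc j * harm j * recip_binom n (Suc j)) sums harmonic_closed_form t n"
    using sums_harm_recip_binom[OF assms(2,3), of m] by simp
  then show ?thesis
    unfolding main[symmetric] S1_def S2_def S3_def S4_def S5_def S6_def S7_def S8_def L_def r_def
      double_harmonic_sum_def recip_binom_def Let_def
    by simp
qed

end
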